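(* Let $\lambda_1,\dots,\lambda_n>0$, $\mu_1>\mu_2>\cdots>\mu_n>0$, $v_1,\dots,v_n$ and $\alpha\in[0,1]$ be given. For any optimal solution $\boldsymbol x^*$ of the queue assignment problem $$(\mathrm{QAP})\qquad \inf_{\boldsymbol x}\ f(\boldsymbol x,\alpha)\quad\text{s.t. }\boldsymbol x\in\mathcal F_\alpha,\ x_i\in[0,1],\ i=1,\dots,n,$$ there exists $(U,E,L)\in\mathcal C(\mathcal I)$ such that either $$x_i^*=1\ (i\in U),\quad x_i^*=0\ (i\in L),\quad x_i^*\in[0,1]\ (i\in E),$$ or $$x_i^*=0\ (i\in U),\quad x_i^*=1\ (i\in L),\quad x_i^*\in[0,1]\ (i\in E).$$
   Context: There are $n$ customer types; type $i$ arrives as a Poisson process with rate $\lambda_i$ and has a service time $S_i$ (nonnegative random variable, under a unit-capacity server) with $\mathbb E[S_i]=1/\mu_i$ and $\mathbb E[S_i^2]=v_i<\infty$; write $\mathcal I=\{S_i\}_{i=1}^n$. Unit capacity is split into two queues with capacities $\alpha$ and $1-\alpha$; $x_i$ is the probability that a type $i$ customer is assigned to the first queue. The expected waiting time is, for $0<\alpha<1$, $$f(\boldsymbol x,\alpha)=\frac{\sum_i\lambda_ix_iv_i}{\alpha^2-\alpha\sum_i\frac{\lambda_ix_i}{\mu_i}}\cdot\frac{\sum_ix_i\lambda_i}{2\sum_i\lambda_i}+\frac{\sum_i\lambda_i(1-x_i)v_i}{(1-\alpha)^2-(1-\alpha)\sum_i\frac{\lambda_i(1-x_i)}{\mu_i}}\cdot\frac{\sum_i(1-x_i)\lambda_i}{2\sum_i\lambda_i},$$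 and $f(\boldsymbol 0,0)=f(\boldsymbol 1,1)=\tfrac12\left(\sum_i\lambda_iv_i\right)/\left(1-\sum_i\lambda_i/\mu_i\right)$. The feasible sets are $\mathcal F_\alpha=\{\boldsymbol x:\sum_i\frac{\lambda_ix_i}{\mu_i}<\alpha<\sum_i\frac{\lambda_ix_i}{\mu_i}+1-\sum_i\frac{\lambda_i}{\mu_i}\}$ for $0<\alpha<1$, and $\mathcal F_0=\{\boldsymbol 0\}$, $\mathcal F_1=\{\boldsymbol 1\}$. For a linear (i.e. affine) function $l(u)=au+b$, the induced partition of $\{1,\dots,n\}$ is $(U_l,E_l,L_l)$ with $U_l=\{i:v_i>l(1/\mu_i)\}$, $E_l=\{i:v_i=l(1/\mu_i)\}$, $L_l=\{i:v_i<l(1/\mu_i)\}$. The configuration set is $$\mathcal C(\mathcal I)=\{(U,E,L):(U,E,L)\text{ is the induced partition of some linear function } l,\ |E|\ge2\}.$$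
   Formalization: The formal theorem assumes n ≥ 2: for n = 1 no partition has |E| ≥ 2, so C(I) is empty, while an optimal solution exists (e.g. α = 1, x = 1). *)

theory Defs
  imports "HOL-Probability.Probability"
begin

text \<open>
  Customer types are the indices \<open>1, \<dots>, n\<close>; vectors indexed by types are functions on \<open>nat\<close>
  of which only the values on \<open>{1..n}\<close> matter.  The arguments \<open>lam\<close>, \<open>mu\<close>, \<open>v\<close> are the arrival
  rates, the service rates (reciprocals of the mean service times) and the second moments of the
  service times.
\<close>

text \<open>
  The boundary values are prescribed only at \<open>(\<zero>, 0)\<close> and \<open>(\<one>, 1)\<close>.  These are the only feasible
  points with \<open>\<alpha> \<in> {0, 1}\<close>, so the value elsewhere on the boundary is immaterial.
\<close>

definition expected_wait ::
  "nat \<Rightarrow> (nat \<Rightarrow> real) \<Rightarrow> (nat \<Rightarrow> real) \<Rightarrow> (nat \<Rightarrow> real) \<Rightarrow> (nat \<Rightarrow> real) \<Rightarrow> real \<Rightarrow> real" where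
  "expected_wait n lam mu v x \<alpha> =
    (if 0 < \<alpha> \<and> \<alpha> < 1 then
       (\<Sum>i=1..n. lam i * x i * v i) / (\<alpha>\<^sup>2 - \<alpha> * (\<Sum>i=1..n. lam i * x i / mu i))
         * ((\<Sum>i=1..n. x i * lam i) / (2 * (\<Sum>i=1..n. lam i)))
       + (\<Sum>i=1..n. lam i * (1 - x i) * v i)
           / ((1 - \<alpha>)\<^sup>2 - (1 - \<alpha>) * (\<Sum>i=1..n. lam i * (1 - x i) / mu i))
         * ((\<Sum>i=1..n. (1 - x i) * lam i) / (2 * (\<Sum>i=1..n. lam i)))
     else 1 / 2 * (\<Sum>i=1..n. lam i * v i) / (1 - (\<Sum>i=1..n. lam i / mu i)))"

definition stable_set ::
  "nat \<Rightarrow> (nat \<Rightarrow> real) \<Rightarrow> (nat \<Rightarrow> real) \<Rightarrow> real \<Rightarrow> (nat \<Rightarrow> real) set" where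
  "stable_set n lam mu \<alpha> =
    (if \<alpha> = 0 then {x. \<forall>i\<in>{1..n}. x i = 0}
     else if \<alpha> = 1 then {x. \<forall>i\<in>{1..n}. x i = 1}
     else {x. (\<Sum>i=1..n. lam i * x i / mu i) < \<alpha> \<and>
              \<alpha> < (\<Sum>i=1..n. lam i * x i / mu i) + 1 - (\<Sum>i=1..n. lam i / mu i)})"

definition QAP_optimal ::
  "nat \<Rightarrow> (nat \<Rightarrow> real) \<Rightarrow> (nat \<Rightarrow> real) \<Rightarrow> (nat \<Rightarrow> real) \<Rightarrow> real \<Rightarrow> (nat \<Rightarrow> real) \<Rightarrow> bool" where
  "QAP_optimal n lam mu v \<alpha> =
    is_arg_min (\<lambda>x. expected_wait n lam mu v x \<alpha>)
      (\<lambda>x. x \<in> stable_set n lam mu \<alpha> \<and> (\<forall>i\<in>{1..n}. x i \<in> {0..1}))"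

definition induced_partition ::
  "nat \<Rightarrow> (nat \<Rightarrow> real) \<Rightarrow> (nat \<Rightarrow> real) \<Rightarrow> (real \<Rightarrow> real) \<Rightarrow> nat set \<times> nat set \<times> nat set" where
  "induced_partition n mu v l =
    ({i\<in>{1..n}. v i > l (1 / mu i)},
     {i\<in>{1..n}. v i = l (1 / mu i)},
     {i\<in>{1..n}. v i < l (1 / mu i)})"

definition configuration_set ::
  "nat \<Rightarrow> (nat \<Rightarrow> real) \<Rightarrow> (nat \<Rightarrow> real) \<Rightarrow> (nat set \<times> nat set \<times> nat set) set" where
  "configuration_set n mu v =
    {(U, E, L). (\<exists>a b. (U, E, L) = induced_partition n mu v (\<lambda>u. a * u + b)) \<and> card E \<ge> 2}"

end

theory Submission
  imports Defs
begin

text \<open>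
  Only the sums of \<open>\<lambda>\<^sub>i x\<^sub>i v\<^sub>i\<close>, \<open>\<lambda>\<^sub>i x\<^sub>i / \<mu>\<^sub>i\<close> and \<open>\<lambda>\<^sub>i x\<^sub>i\<close> enter the objective, so
  its partial derivatives are \<open>\<lambda>\<^sub>i (p v\<^sub>i + q / \<mu>\<^sub>i + r)\<close> with \<open>p\<close>, \<open>q\<close>, \<open>r\<close> independent of \<open>i\<close>.
  If \<open>(p, q, r) \<noteq> 0\<close>, the first-order conditions say that a line (tilted slightly if vertical) weakly
  separates the types in the first queue from those in the second, and it can be moved until it
  passes through two of the points \<open>(1 / \<mu>\<^sub>i, v\<^sub>i)\<close>.  If \<open>p = q = r = 0\<close>, then \<open>\<alpha> = 1 / 2\<close> and along
  every line the change of the objective has the sign of a product of two linear forms of the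
  direction.  Exchanging two types makes this product negative unless their points lie on one
  particular line, so both queues are used only if all points are collinear.
\<close>

definition config_assignment ::
  "nat \<Rightarrow> (nat \<Rightarrow> real) \<Rightarrow> (nat \<Rightarrow> real) \<Rightarrow> (nat \<Rightarrow> real) \<Rightarrow> bool" where
  "config_assignment n mu v x \<longleftrightarrow> (\<exists>(U, E, L) \<in> configuration_set n mu v.
      ((\<forall>i\<in>U. x i = 1) \<and> (\<forall>i\<in>L. x i = 0) \<and> (\<forall>i\<in>E. x i \<in> {0..1})) \<or>
      ((\<forall>i\<in>U. x i = 0) \<and> (\<forall>i\<in>L. x i = 1) \<and> (\<forall>i\<in>E. x i \<in> {0..1})))"

section \<open>Moving a line until it meets two points\<close>

text \<open>Translate the line by the residual \<open>d k\<close> of smallest absolute value.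
  Subtracting \<open>d k\<close> from another residual may make it zero but cannot reverse its sign,
  so no point changes sides.\<close>

lemma line_through_point:
  fixes u v :: "'i \<Rightarrow> real"
  assumes "finite I" "I \<noteq> {}"
  obtains b' e where "e \<in> I" "v e = a * u e + b'"
    "\<And>i. i \<in> I \<Longrightarrow> v i > a * u i + b' \<Longrightarrow> v i > a * u i + b"
    "\<And>i. i \<in> I \<Longrightarrow> v i < a * u i + b' \<Longrightarrow> v i < a * u i + b"
proof -
  define d where "d i = v i - (a * u i + b)" for i
  have "\<exists>k\<in>I. \<forall>i\<in>I. \<bar>d k\<bar> \<le> \<bar>d i\<bar>"
    using ex_min_if_finite[of "(\<lambda>i. \<bar>d i\<bar>) ` I"] assms by (auto simp: not_less)
  then obtain k where k: "k \<in> I" "\<And>i. i \<in> I \<Longrightarrow> \<bar>d k\<bar> \<le> \<bar>d i\<bar>" by blast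
  show ?thesis
  proof (rule that[of k "b + d k"])
    fix i assume i: "i \<in> I"
    show "v i > a * u i + b" if "v i > a * u i + (b + d k)"
      using k(2)[OF i] that unfolding d_def by linarith
    show "v i < a * u i + b" if "v i < a * u i + (b + d k)"
      using k(2)[OF i] that unfolding d_def by linarith
  qed (use k in \<open>auto simp: d_def\<close>)
qed

text \<open>Rotate about the point of \<open>e\<close>. The change of slope that brings point
  \<open>i\<close> onto the line is \<open>s i\<close>, and the one of smallest absolute value is
  applied, so again a residual can vanish but not reverse its sign.\<close>

lemma line_rotate:
  fixes u v :: "'i \<Rightarrow> real"
  assumes "finite I" "card I \<ge> 2" and inj: "inj_on u I" and e: "e \<in> I" "v e = a * u e + b"
  obtains a' b' j where "j \<in> I" "j \<noteq> e" "v e = a' * u e + b'" "v j = a' * u j + b'"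
    "\<And>i. i \<in> I \<Longrightarrow> v i > a' * u i + b' \<Longrightarrow> v i > a * u i + b"
    "\<And>i. i \<in> I \<Longrightarrow> v i < a' * u i + b' \<Longrightarrow> v i < a * u i + b"
proof -
  define s where "s i = (v i - v e) / (u i - u e) - a" for i
  have ne: "I - {e} \<noteq> {}"
  proof
    assume "I - {e} = {}"
    then have "I \<subseteq> {e}" by auto
    then have "card I \<le> card {e}" by (intro card_mono) auto
    then show False using assms(2) by simp
  qed
  have "\<exists>k\<in>I - {e}. \<forall>i\<in>I - {e}. \<bar>s k\<bar> \<le> \<bar>s i\<bar>"
    using ex_min_if_finite[of "(\<lambda>i. \<bar>s i\<bar>) ` (I - {e})"] assms(1) ne by (auto simp: not_less)
  then obtain k where k: "k \<in> I" "k \<noteq> e" "\<And>i. i \<in> I \<Longrightarrow> i \<noteq> e \<Longrightarrow> \<bar>s k\<bar> \<le> \<bar>s i\<bar>" by blast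
  define b' where "b' = v e - (a + s k) * u e"
  \<comment> \<open>At \<open>i = e\<close> the quotient in \<open>s e\<close> is 0 / 0, but the
    factor \<open>u i - u e\<close> makes both sides vanish.\<close>
  have vi: "v i - v e = (s i + a) * (u i - u e)" if "i \<in> I" for i
    using that inj e(1) by (cases "i = e") (auto simp: s_def dest: inj_onD)
  have old: "v i - (a * u i + b) = s i * (u i - u e)" if "i \<in> I" for i
    using vi[OF that] e(2) by (simp add: algebra_simps)
  have new: "v i - ((a + s k) * u i + b') = (s i - s k) * (u i - u e)" if "i \<in> I" for i
    using vi[OF that] by (simp add: b'_def algebra_simps)
  have sgn_s: "s i - s k > 0 \<Longrightarrow> s i > 0" "s i - s k < 0 \<Longrightarrow> s i < 0" if "i \<in> I" "i \<noteq> e" for i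
    using k(3)[OF that] by linarith+
  show ?thesis
  proof (rule that[of k "a + s k" b'])
    fix i assume i: "i \<in> I"
    show "v i > a * u i + b" if "v i > (a + s k) * u i + b'"
    proof -
      have "0 < (s i - s k) * (u i - u e)" using that new[OF i] by linarith
      moreover from this have "i \<noteq> e" by auto
      ultimately have "0 < s i * (u i - u e)"
        using sgn_s[OF i] by (auto simp: zero_less_mult_iff)
      then show ?thesis using old[OF i] by linarith
    qed
    show "v i < a * u i + b" if "v i < (a + s k) * u i + b'"
    proof -
      have "(s i - s k) * (u i - u e) < 0" using that new[OF i] by linarith
      moreover from this have "i \<noteq> e" by auto
      ultimately have "s i * (u i - u e) < 0"
        using sgn_s[OF i] by (auto simp: mult_less_0_iff)
      then show ?thesis using old[OF i] by linarith
    qed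
  qed (use k new[of k] in \<open>auto simp: b'_def\<close>)
qed

text \<open>Any weakly separating line suffices, even one through no point at all: translating and
  then rotating it only moves types from the strict sides into \<open>E\<close>, where the
  assignment is unconstrained.\<close>

lemma config_assignment_line:
  assumes "n \<ge> 2" and inj: "inj_on (\<lambda>i. 1 / mu i) {1..n}" and x: "\<And>i. i \<in> {1..n} \<Longrightarrow> x i \<in> {0..1}"
    and UL: "((\<forall>i\<in>{1..n}. v i > a * (1 / mu i) + b \<longrightarrow> x i = 1) \<and>
              (\<forall>i\<in>{1..n}. v i < a * (1 / mu i) + b \<longrightarrow> x i = 0)) \<or>
             ((\<forall>i\<in>{1..n}. v i > a * (1 / mu i) + b \<longrightarrow> x i = 0) \<and>
              (\<forall>i\<in>{1..n}. v i < a * (1 / mu i) + b \<longrightarrow> x i = 1))"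
  shows "config_assignment n mu v x"
proof -
  define u where "u i = 1 / mu i" for i
  obtain b1 e where 1: "e \<in> {1..n}" "v e = a * u e + b1"
    "\<And>i. i \<in> {1..n} \<Longrightarrow> v i > a * u i + b1 \<Longrightarrow> v i > a * u i + b"
    "\<And>i. i \<in> {1..n} \<Longrightarrow> v i < a * u i + b1 \<Longrightarrow> v i < a * u i + b"
    by (rule line_through_point[where I = "{1..n}" and u = u and v = v and a = a and b = b])
      (use assms(1) in auto)
  obtain a2 b2 j where 2: "j \<in> {1..n}" "j \<noteq> e" "v e = a2 * u e + b2" "v j = a2 * u j + b2"
    "\<And>i. i \<in> {1..n} \<Longrightarrow> v i > a2 * u i + b2 \<Longrightarrow> v i > a * u i + b1"
    "\<And>i. i \<in> {1..n} \<Longrightarrow> v i < a2 * u i + b2 \<Longrightarrow> v i < a * u i + b1"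
    by (rule line_rotate[of "{1..n}" u e v a b1]) (use assms(1) inj 1 in \<open>simp_all add: u_def [abs_def]\<close>)
  define U where "U = {i\<in>{1..n}. v i > a2 * u i + b2}"
  define E where "E = {i\<in>{1..n}. v i = a2 * u i + b2}"
  define L where "L = {i\<in>{1..n}. v i < a2 * u i + b2}"
  have "{e, j} \<subseteq> E" using 1 2 by (auto simp: E_def)
  then have "card {e, j} \<le> card E" by (intro card_mono) (auto simp: E_def)
  then have "card E \<ge> 2" using 2(2) by simp
  moreover have "(U, E, L) = induced_partition n mu v (\<lambda>u. a2 * u + b2)"
    by (simp add: induced_partition_def U_def E_def L_def u_def)
  ultimately have "(U, E, L) \<in> configuration_set n mu v"
    unfolding configuration_set_def by blast
  moreover have "\<forall>i\<in>U. v i > a * (1 / mu i) + b" "\<forall>i\<in>L. v i < a * (1 / mu i) + b"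
    using 1(3,4) 2(5,6) by (auto simp: U_def L_def u_def)
  moreover have "U \<subseteq> {1..n}" "L \<subseteq> {1..n}" "\<forall>i\<in>E. x i \<in> {0..1}"
    using x by (auto simp: U_def E_def L_def)
  ultimately show ?thesis
    using UL unfolding config_assignment_def
    by (intro bexI[of _ "(U, E, L)"]) (simp_all, blast)
qed

section \<open>Configurations from the signs of an affine form\<close>

lemma config_assignment_sign_nonvertical:
  assumes "n \<ge> 2" "inj_on (\<lambda>i. 1 / mu i) {1..n}" and x: "\<And>i. i \<in> {1..n} \<Longrightarrow> x i \<in> {0..1}"
    and pos: "\<And>i. i \<in> {1..n} \<Longrightarrow> p * v i + q * (1 / mu i) + r > 0 \<Longrightarrow> x i = 0"
    and neg: "\<And>i. i \<in> {1..n} \<Longrightarrow> p * v i + q * (1 / mu i) + r < 0 \<Longrightarrow> x i = 1"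
    and p: "p \<noteq> 0"
  shows "config_assignment n mu v x"
proof (rule config_assignment_line[where a = "- q / p" and b = "- r / p"])
  \<comment> \<open>Up to the factor \<open>p\<close>, the form is the vertical offset from a line;
    the sign of \<open>p\<close> decides which of the two alternatives occurs.\<close>
  have eq: "p * v i + q * (1 / mu i) + r = p * (v i - (- q / p * (1 / mu i) + - r / p))" for i
  proof -
    have "p * (q / p * (1 / mu i)) = q * (1 / mu i)" "p * (r / p) = r" using p by auto
    then show ?thesis by (simp add: right_diff_distrib distrib_left)
  qed
  show "((\<forall>i\<in>{1..n}. v i > - q / p * (1 / mu i) + - r / p \<longrightarrow> x i = 1) \<and>
              (\<forall>i\<in>{1..n}. v i < - q / p * (1 / mu i) + - r / p \<longrightarrow> x i = 0)) \<or>
             ((\<forall>i\<in>{1..n}. v i > - q / p * (1 / mu i) + - r / p \<longrightarrow> x i = 0) \<and>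
              (\<forall>i\<in>{1..n}. v i < - q / p * (1 / mu i) + - r / p \<longrightarrow> x i = 1))"
  proof (cases "p > 0")
    case True
    then show ?thesis using pos neg unfolding eq zero_less_mult_iff mult_less_0_iff by force
  next
    case False
    then have "p < 0" using p by simp
    then show ?thesis using pos neg unfolding eq zero_less_mult_iff mult_less_0_iff by force
  qed
qed (use assms in auto)

text \<open>No point lies above the horizontal line through a highest one.\<close>

lemma config_assignment_all_0:
  assumes "n \<ge> 2" "inj_on (\<lambda>i. 1 / mu i) {1..n}" and x: "\<And>i. i \<in> {1..n} \<Longrightarrow> x i = 0"
  shows "config_assignment n mu v x"
proof (rule config_assignment_line[where a = 0 and b = "Max (v ` {1..n})"])
  have "v i \<le> Max (v ` {1..n})" if "i \<in> {1..n}" for i using that by simp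
  then show "((\<forall>i\<in>{1..n}. v i > 0 * (1 / mu i) + Max (v ` {1..n}) \<longrightarrow> x i = 1) \<and>
              (\<forall>i\<in>{1..n}. v i < 0 * (1 / mu i) + Max (v ` {1..n}) \<longrightarrow> x i = 0)) \<or>
             ((\<forall>i\<in>{1..n}. v i > 0 * (1 / mu i) + Max (v ` {1..n}) \<longrightarrow> x i = 0) \<and>
              (\<forall>i\<in>{1..n}. v i < 0 * (1 / mu i) + Max (v ` {1..n}) \<longrightarrow> x i = 1))"
    using x by (force simp: not_less[symmetric])
qed (use assms in auto)

text \<open>A configuration for the zero assignment has \<open>U\<close> or \<open>L\<close> empty,
  so with the alternatives exchanged it also serves the constant one.\<close>

lemma config_assignment_all_1:
  assumes "n \<ge> 2" "inj_on (\<lambda>i. 1 / mu i) {1..n}" and x: "\<And>i. i \<in> {1..n} \<Longrightarrow> x i = 1"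
  shows "config_assignment n mu v x"
proof -
  have "config_assignment n mu v (\<lambda>_. 0)" using assms by (intro config_assignment_all_0) auto
  then obtain U E L where *: "(U, E, L) \<in> configuration_set n mu v"
      "(\<forall>i\<in>U. (0::real) = 1) \<and> (\<forall>i\<in>L. (0::real) = 0) \<or>
       (\<forall>i\<in>U. (0::real) = 0) \<and> (\<forall>i\<in>L. (0::real) = 1)"
    unfolding config_assignment_def by auto
  have "U \<subseteq> {1..n}" "L \<subseteq> {1..n}" "E \<subseteq> {1..n}"
    using *(1) by (auto simp: configuration_set_def induced_partition_def)
  then show ?thesis
    using * x unfolding config_assignment_def
    by (intro bexI[of _ "(U, E, L)"]) (auto simp: subset_iff)
qed

lemma config_assignment_sign:
  assumes "n \<ge> 2" and inj: "inj_on (\<lambda>i. 1 / mu i) {1..n}"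
    and x: "\<And>i. i \<in> {1..n} \<Longrightarrow> x i \<in> {0..1}"
    and pos: "\<And>i. i \<in> {1..n} \<Longrightarrow> p * v i + q * (1 / mu i) + r > 0 \<Longrightarrow> x i = 0"
    and neg: "\<And>i. i \<in> {1..n} \<Longrightarrow> p * v i + q * (1 / mu i) + r < 0 \<Longrightarrow> x i = 1"
    and pqr: "p \<noteq> 0 \<or> q \<noteq> 0 \<or> r \<noteq> 0"
  shows "config_assignment n mu v x"
proof -
  consider "p \<noteq> 0" | "p = 0" "q \<noteq> 0" | "p = 0" "q = 0" "r > 0" | "p = 0" "q = 0" "r < 0"
    using pqr by linarith
  then show ?thesis
  proof cases
    case 1
    then show ?thesis using assms by (intro config_assignment_sign_nonvertical[where p = p and q = q and r = r])
  next
    case 2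
    define s where "s i = q * (1 / mu i) + r" for i
    \<comment> \<open>At most one point lies on the vertical line; the tilt is about this point.\<close>
    obtain w where w: "\<And>i. i \<in> {1..n} \<Longrightarrow> s i = 0 \<Longrightarrow> v i = w"
    proof (cases "\<exists>e\<in>{1..n}. s e = 0")
      case True
      then obtain e where e: "e \<in> {1..n}" "s e = 0" by blast
      have "i = e" if "i \<in> {1..n}" "s i = 0" for i
      proof (rule inj_onD[OF inj])
        have "q * (1 / mu i) = q * (1 / mu e)" using e(2) that(2) unfolding s_def by linarith
        then show "1 / mu i = 1 / mu e" using 2 by (simp only: mult_cancel_left) simp
      qed (use e that in auto)
      then show ?thesis using that[of "v e"] by blast
    qed (use that in blast)
    \<comment> \<open>Nonzero signs persist for small tilts by continuity; where
      \<open>s i = 0\<close>, the choice of \<open>w\<close> keeps the tilted form zero for every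
      \<open>t\<close>.\<close>
    have ev: "\<forall>\<^sub>F t in at_right 0. sgn (t * (v i - w) + s i) = sgn (s i)" if i: "i \<in> {1..n}" for i
    proof -
      have lim: "((\<lambda>t. t * (v i - w) + s i) \<longlongrightarrow> 0 * (v i - w) + s i) (at_right 0)"
        by (intro tendsto_intros)
      consider "s i > 0" | "s i < 0" | "s i = 0" by linarith
      then show ?thesis
      proof cases
        case 1
        then show ?thesis using order_tendstoD(1)[OF lim, of 0] by (auto elim: eventually_mono)
      next
        case 2
        then show ?thesis using order_tendstoD(2)[OF lim, of 0] by (auto elim: eventually_mono)
      next
        case 3
        then show ?thesis using w[OF i] by simp
      qed
    qed
    have "\<forall>\<^sub>F t in at_right 0. t > 0 \<and> (\<forall>i\<in>{1..n}. sgn (t * (v i - w) + s i) = sgn (s i))"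
      using ev by (intro eventually_conj eventually_ball_finite ballI eventually_at_right_less) auto
    then obtain t where t: "t > 0" "\<And>i. i \<in> {1..n} \<Longrightarrow> sgn (t * (v i - w) + s i) = sgn (s i)"
      by (blast dest: eventually_happens'[OF trivial_limit_at_right_real])
    have eq: "t * v i + q * (1 / mu i) + (r - t * w) = t * (v i - w) + s i" for i
      by (simp add: s_def algebra_simps)
    have s: "p * v i + q * (1 / mu i) + r = s i" for i using 2 by (simp add: s_def)
    show ?thesis
    proof (rule config_assignment_sign_nonvertical[where p = t and q = q and r = "r - t * w"])
      fix i assume i: "i \<in> {1..n}"
      show "x i = 0" if "t * v i + q * (1 / mu i) + (r - t * w) > 0"
        using that pos[OF i] t(2)[OF i] unfolding eq s by (metis sgn_greater)
      show "x i = 1" if "t * v i + q * (1 / mu i) + (r - t * w) < 0"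
        using that neg[OF i] t(2)[OF i] unfolding eq s by (metis sgn_less)
    qed (use assms t(1) in auto)
  next
    case 3
    then show ?thesis using assms by (intro config_assignment_all_0) auto
  next
    case 4
    then show ?thesis using assms by (intro config_assignment_all_1) auto
  qed
qed

section \<open>Optimality along feasible directions\<close>

text \<open>One queue's share of the objective without the common factor
  \<open>1 / (2 * sum of lam)\<close>. The second queue is the same function at 1 - \<alpha> and the
  complementary assignment.\<close>

definition queue_ratio ::
  "nat \<Rightarrow> (nat \<Rightarrow> real) \<Rightarrow> (nat \<Rightarrow> real) \<Rightarrow> (nat \<Rightarrow> real) \<Rightarrow> real \<Rightarrow> (nat \<Rightarrow> real) \<Rightarrow> real" where
  "queue_ratio n lam mu v \<alpha> x =
    (\<Sum>i=1..n. lam i * x i * v i) * (\<Sum>i=1..n. lam i * x i) /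
      (\<alpha>\<^sup>2 - \<alpha> * (\<Sum>i=1..n. lam i * x i / mu i))"

lemma expected_wait_eq_ratio:
  assumes "0 < \<alpha>" "\<alpha> < 1"
  shows "expected_wait n lam mu v x \<alpha> =
    (queue_ratio n lam mu v \<alpha> x + queue_ratio n lam mu v (1 - \<alpha>) (\<lambda>i. 1 - x i)) /
      (2 * (\<Sum>i=1..n. lam i))"
  using assms by (simp add: expected_wait_def queue_ratio_def add_divide_distrib mult.commute)

text \<open>Numerator factors and denominator are affine in \<open>t\<close>, so along a line the
  objective is a rational function of one variable.\<close>

lemma queue_ratio_shift:
  "queue_ratio n lam mu v \<alpha> (\<lambda>i. x i + t * h i) =
    ((\<Sum>i=1..n. lam i * x i * v i) + t * (\<Sum>i=1..n. lam i * h i * v i)) *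
    ((\<Sum>i=1..n. lam i * x i) + t * (\<Sum>i=1..n. lam i * h i)) /
    ((\<alpha>\<^sup>2 - \<alpha> * (\<Sum>i=1..n. lam i * x i / mu i)) - t * (\<alpha> * (\<Sum>i=1..n. lam i * h i / mu i)))"
  by (simp add: queue_ratio_def sum.distrib sum_distrib_left algebra_simps add_divide_distrib)

lemma sum_complement:
  fixes lam x mu :: "nat \<Rightarrow> real"
  shows "(\<Sum>i=1..n. lam i * (1 - x i) / mu i) = (\<Sum>i=1..n. lam i / mu i) - (\<Sum>i=1..n. lam i * x i / mu i)"
  by (simp add: sum_subtractf algebra_simps diff_divide_distrib)

lemma stable_set_iff:
  assumes "0 < \<alpha>" "\<alpha> < 1"
  shows "x \<in> stable_set n lam mu \<alpha> \<longleftrightarrow>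
    (\<Sum>i=1..n. lam i * x i / mu i) < \<alpha> \<and> (\<Sum>i=1..n. lam i * (1 - x i) / mu i) < 1 - \<alpha>"
  unfolding stable_set_def sum_complement using assms by auto

text \<open>Stability is a strict, hence open, condition, and a coordinate at a bound of the box
  stays or moves inwards.\<close>

lemma feasible_direction:
  assumes \<alpha>: "0 < \<alpha>" "\<alpha> < 1" and st: "x \<in> stable_set n lam mu \<alpha>"
    and x: "\<forall>i\<in>{1..n}. x i \<in> {0..1}"
    and h: "\<forall>i\<in>{1..n}. (h i > 0 \<longrightarrow> x i < 1) \<and> (h i < 0 \<longrightarrow> x i > 0)"
  shows "\<forall>\<^sub>F t in at_right 0. (\<lambda>i. x i + t * h i) \<in> stable_set n lam mu \<alpha> \<and>
    (\<forall>i\<in>{1..n}. x i + t * h i \<in> {0..1})"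
proof (intro eventually_conj)
  \<comment> \<open>Multiplying by \<open>inverse (mu i)\<close> instead of dividing avoids the side
    condition that \<open>mu i\<close> is nonzero.\<close>
  have "((\<lambda>t. \<Sum>i=1..n. lam i * (x i + t * h i) / mu i) \<longlongrightarrow>
      (\<Sum>i=1..n. lam i * (x i + 0 * h i) * inverse (mu i))) (at_right 0)"
    unfolding divide_inverse by (intro tendsto_intros)
  moreover have "((\<lambda>t. \<Sum>i=1..n. lam i * (1 - (x i + t * h i)) / mu i) \<longlongrightarrow>
      (\<Sum>i=1..n. lam i * (1 - (x i + 0 * h i)) * inverse (mu i))) (at_right 0)"
    unfolding divide_inverse by (intro tendsto_intros)
  ultimately show "\<forall>\<^sub>F t in at_right 0. (\<lambda>i. x i + t * h i) \<in> stable_set n lam mu \<alpha>"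
    using st unfolding stable_set_iff[OF \<alpha>]
    by (intro eventually_conj; elim order_tendstoD(2)) (simp_all add: divide_inverse)
  show "\<forall>\<^sub>F t in at_right 0. \<forall>i\<in>{1..n}. x i + t * h i \<in> {0..1}"
  proof (intro eventually_ball_finite ballI)
    fix i assume i: "i \<in> {1..n}"
    have lim: "((\<lambda>t. x i + t * h i) \<longlongrightarrow> x i + 0 * h i) (at_right 0)"
      by (intro tendsto_intros)
    have pos: "\<forall>\<^sub>F t :: real in at_right 0. t > 0" by (rule eventually_at_right_less)
    consider "h i = 0" | "h i > 0" | "h i < 0" by linarith
    then show "\<forall>\<^sub>F t in at_right 0. x i + t * h i \<in> {0..1}"
    proof cases
      case 1
      then show ?thesis using x i by simp
    next
      case 2
      then have "\<forall>\<^sub>F t in at_right 0. x i + t * h i < 1"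
        using h i by (intro order_tendstoD(2)[OF lim]) simp
      with pos show ?thesis
        by eventually_elim (use 2 x i in auto)
    next
      case 3
      then have "\<forall>\<^sub>F t in at_right 0. x i + t * h i > 0"
        using h i by (intro order_tendstoD(1)[OF lim]) simp
      with pos show ?thesis
      proof eventually_elim
        case (elim t)
        then have "t * h i < 0" using 3 by (simp add: mult_pos_neg)
        then show ?case using elim bspec[OF x i] by simp
      qed
    qed
  qed auto
qed

lemma QAP_optimal_direction:
  assumes \<alpha>: "0 < \<alpha>" "\<alpha> < 1" and opt: "QAP_optimal n lam mu v \<alpha> x"
    and Lam: "(\<Sum>i=1..n. lam i) > 0"
    and h: "\<forall>i\<in>{1..n}. (h i > 0 \<longrightarrow> x i < 1) \<and> (h i < 0 \<longrightarrow> x i > 0)"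
  shows "\<forall>\<^sub>F t in at_right 0.
    queue_ratio n lam mu v \<alpha> x + queue_ratio n lam mu v (1 - \<alpha>) (\<lambda>i. 1 - x i) \<le>
    queue_ratio n lam mu v \<alpha> (\<lambda>i. x i + t * h i) +
      queue_ratio n lam mu v (1 - \<alpha>) (\<lambda>i. (1 - x i) + t * - h i)"
proof -
  have x: "x \<in> stable_set n lam mu \<alpha>" "\<forall>i\<in>{1..n}. x i \<in> {0..1}"
    and min: "\<And>y. y \<in> stable_set n lam mu \<alpha> \<Longrightarrow> \<forall>i\<in>{1..n}. y i \<in> {0..1} \<Longrightarrow>
      expected_wait n lam mu v x \<alpha> \<le> expected_wait n lam mu v y \<alpha>"
    using opt unfolding QAP_optimal_def is_arg_min_linorder by auto
  show ?thesis
    using feasible_direction[where h = h, OF \<alpha> x h]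
  proof eventually_elim
    case (elim t)
    have "(\<lambda>i. 1 - (x i + t * h i)) = (\<lambda>i. (1 - x i) + t * - h i)" by (simp add: algebra_simps)
    then show ?case
      using min[of "\<lambda>i. x i + t * h i"] elim Lam
      by (simp add: expected_wait_eq_ratio[OF \<alpha>] divide_le_cancel)
  qed
qed

section \<open>First- and second-order behaviour of the ratios\<close>

lemma deriv_nonneg_if_min_right:
  fixes f :: "real \<Rightarrow> real"
  assumes d: "(f has_real_derivative d) (at 0)" and le: "\<forall>\<^sub>F t in at_right 0. f 0 \<le> f t"
  shows "d \<ge> 0"
proof (rule ccontr)
  assume "\<not> d \<ge> 0"
  then obtain e where e: "e > 0" "\<And>t. 0 < t \<Longrightarrow> t < e \<Longrightarrow> f (0 + t) < f 0"
    using DERIV_neg_dec_right[OF d] by auto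
  have "\<forall>\<^sub>F t in at_right 0. t < e \<and> 0 < t \<and> f 0 \<le> f t"
    using le e(1) by (intro eventually_conj eventually_at_right_less)
      (auto simp: eventually_at_right_field)
  then obtain t where "t < e" "0 < t" "f 0 \<le> f t"
    using eventually_happens'[OF trivial_limit_at_right_real] by blast
  then show False using e(2)[of t] by simp
qed

lemma ratio_deriv:
  fixes A C D :: real
  assumes "D \<noteq> 0"
  shows "((\<lambda>t. (A + t * a) * (C + t * c) / (D - t * d)) has_real_derivative
    (C / D * a + A / D * c + A * C / D\<^sup>2 * d)) (at 0)"
  by (rule derivative_eq_intros refl | use assms in \<open>simp add: field_simps power2_eq_square\<close>)+

\<comment> \<open>\<open>A = m D\<close>, \<open>C = k D\<close>: the linear terms of the two queues cancel when the direction is negated.\<close>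
lemma ratio_sum_critical:
  fixes D D' :: real
  assumes "D \<noteq> 0" "D' \<noteq> 0" "D - t * d \<noteq> 0" "D' + t * d \<noteq> 0"
  shows "(m * D + t * a) * (k * D + t * c) / (D - t * d) +
      (m * D' - t * a) * (k * D' - t * c) / (D' + t * d) =
    m * D * (k * D) / D + m * D' * (k * D') / D' +
      t\<^sup>2 * ((a + m * d) * (c + k * d)) * (1 / (D - t * d) + 1 / (D' + t * d))"
proof -
  define X where "X = D - t * d"
  define Y where "Y = D' + t * d"
  have XY: "X \<noteq> 0" "Y \<noteq> 0" using assms by (auto simp: X_def Y_def)
  have D: "D = X + t * d" "D' = Y - t * d" by (auto simp: X_def Y_def)
  \<comment> \<open>Here the numerator is
    \<open>(m * X + t * (a + m * d)) * (k * X + t * (c + k * d))\<close>. For \<open>Y\<close> the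
    sign of \<open>t\<close> is reversed, which cancels the linear terms in the sum.\<close>
  have "(m * D + t * a) * (k * D + t * c) / X =
      m * k * X + t * (m * (c + k * d) + k * (a + m * d)) + t\<^sup>2 * ((a + m * d) * (c + k * d)) * (1 / X)"
    using XY unfolding D by (simp add: field_simps power2_eq_square)
  moreover have "(m * D' - t * a) * (k * D' - t * c) / Y =
      m * k * Y - t * (m * (c + k * d) + k * (a + m * d)) + t\<^sup>2 * ((a + m * d) * (c + k * d)) * (1 / Y)"
    using XY unfolding D by (simp add: field_simps power2_eq_square)
  moreover have "m * D * (k * D) / D + m * D' * (k * D') / D' = m * k * X + m * k * Y"
    using assms(1,2) by (simp add: X_def Y_def algebra_simps)
  ultimately show ?thesis unfolding X_def[symmetric] Y_def[symmetric]
    by (simp add: algebra_simps)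
qed

section \<open>Optimal assignments for an interior capacity split\<close>

lemma QAP_optimal_config_assignment:
  assumes n: "n \<ge> 2" and lam: "\<And>i. i \<in> {1..n} \<Longrightarrow> lam i > 0"
    and mu: "\<And>i. i \<in> {1..n} \<Longrightarrow> mu i > 0" and inj: "inj_on (\<lambda>i. 1 / mu i) {1..n}"
    and v: "\<And>i. i \<in> {1..n} \<Longrightarrow> v i > 0" and \<alpha>: "0 < \<alpha>" "\<alpha> < 1"
    and opt: "QAP_optimal n lam mu v \<alpha> x"
  shows "config_assignment n mu v x"
proof -
  define A where "A = (\<Sum>i=1..n. lam i * x i * v i)"
  define C where "C = (\<Sum>i=1..n. lam i * x i)"
  define D where "D = \<alpha>\<^sup>2 - \<alpha> * (\<Sum>i=1..n. lam i * x i / mu i)"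
  define A' where "A' = (\<Sum>i=1..n. lam i * (1 - x i) * v i)"
  define C' where "C' = (\<Sum>i=1..n. lam i * (1 - x i))"
  define D' where "D' = (1 - \<alpha>)\<^sup>2 - (1 - \<alpha>) * (\<Sum>i=1..n. lam i * (1 - x i) / mu i)"
  have x: "x \<in> stable_set n lam mu \<alpha>" "\<And>i. i \<in> {1..n} \<Longrightarrow> x i \<in> {0..1}"
    using opt unfolding QAP_optimal_def is_arg_min_linorder by auto
  have D: "D > 0" "D' > 0"
    using x(1) \<alpha> unfolding stable_set_iff[OF \<alpha>] D_def D'_def power2_eq_square
    by (simp_all flip: right_diff_distrib)
  have ne: "{1..n} \<noteq> {}" using n by simp
  \<comment> \<open>The totals over both queues are positive even if one queue is empty; this later
    gives \<open>k > 0\<close> and \<open>m > 0\<close>.\<close>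
  have "A + A' = (\<Sum>i=1..n. lam i * v i)" "C + C' = (\<Sum>i=1..n. lam i)"
    unfolding A_def A'_def C_def C'_def
    by (simp_all add: sum.distrib[symmetric] algebra_simps)
  moreover have Lam: "(\<Sum>i=1..n. lam i) > 0" "(\<Sum>i=1..n. lam i * v i) > 0"
    using lam v ne by (auto intro!: sum_pos)
  ultimately have AC: "A + A' > 0" "C + C' > 0" by auto

  define sv where "sv h = (\<Sum>i=1..n. lam i * h i * v i)" for h
  define sm where "sm h = (\<Sum>i=1..n. lam i * h i / mu i)" for h
  define s1 where "s1 h = (\<Sum>i=1..n. lam i * h i)" for h
  have minimal: "\<forall>\<^sub>F t in at_right 0. A * C / D + A' * C' / D' \<le>
      (A + t * sv h) * (C + t * s1 h) / (D - t * (\<alpha> * sm h)) +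
      (A' + t * - sv h) * (C' + t * - s1 h) / (D' - t * - ((1 - \<alpha>) * sm h))"
    if "\<forall>i\<in>{1..n}. (h i > 0 \<longrightarrow> x i < 1) \<and> (h i < 0 \<longrightarrow> x i > 0)" for h
    using QAP_optimal_direction[where h = h, OF \<alpha> opt Lam(1) that]
    unfolding queue_ratio_shift unfolding queue_ratio_def
    by (simp add: A_def C_def D_def A'_def C'_def D'_def sv_def sm_def s1_def sum_negf)

  \<comment> \<open>Coefficients of the directional derivative: \<open>p\<close> and
    \<open>r\<close> come from the two numerator factors, \<open>q\<close> from the
    denominators.\<close>
  define p where "p = C / D - C' / D'"
  define q where "q = \<alpha> * (A * C / D\<^sup>2) - (1 - \<alpha>) * (A' * C' / D'\<^sup>2)"
  define r where "r = A / D - A' / D'"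
  have first: "p * sv h + q * sm h + r * s1 h \<ge> 0"
    if h: "\<forall>i\<in>{1..n}. (h i > 0 \<longrightarrow> x i < 1) \<and> (h i < 0 \<longrightarrow> x i > 0)" for h
  proof -
    have "0 \<le> (C / D * sv h + A / D * s1 h + A * C / D\<^sup>2 * (\<alpha> * sm h)) +
      (C' / D' * - sv h + A' / D' * - s1 h + A' * C' / D'\<^sup>2 * - ((1 - \<alpha>) * sm h))"
      by (rule deriv_nonneg_if_min_right[OF DERIV_add[OF ratio_deriv ratio_deriv]])
        (use D minimal[OF h] in simp_all)
    also have "\<dots> = p * sv h + q * sm h + r * s1 h"
    proof -
      have "p * b = C / D * b - C' / D' * b" "r * b = A / D * b - A' / D' * b"
        "q * b = A * C / D\<^sup>2 * (\<alpha> * b) - A' * C' / D'\<^sup>2 * ((1 - \<alpha>) * b)" for b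
        unfolding p_def q_def r_def left_diff_distrib
        by (simp_all add: mult_ac left_diff_distrib right_diff_distrib diff_divide_distrib)
      then show ?thesis by simp
    qed
    finally show ?thesis .
  qed
  have single: "sv (\<lambda>j. if j = i then c else 0) = lam i * c * v i"
    "sm (\<lambda>j. if j = i then c else 0) = lam i * c / mu i"
    "s1 (\<lambda>j. if j = i then c else 0) = lam i * c" if "i \<in> {1..n}" for i c
    using that by (simp_all add: sv_def sm_def s1_def if_distrib if_distribR sum.delta cong: if_cong)
  \<comment> \<open>Test directions: raise a single coordinate if it is below 1, lower it if it is
    above 0.\<close>
  have kkt: "x i < 1 \<Longrightarrow> p * v i + q * (1 / mu i) + r \<ge> 0"
    "x i > 0 \<Longrightarrow> p * v i + q * (1 / mu i) + r \<le> 0" if i: "i \<in> {1..n}" for i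
  proof -
    have eq: "p * sv (\<lambda>j. if j = i then c else 0) + q * sm (\<lambda>j. if j = i then c else 0) +
        r * s1 (\<lambda>j. if j = i then c else 0) = (lam i * c) * (p * v i + q * (1 / mu i) + r)" for c
      unfolding single[OF i] by (simp add: algebra_simps)
    show "p * v i + q * (1 / mu i) + r \<ge> 0" if "x i < 1"
      using first[of "\<lambda>j. if j = i then 1 else 0", unfolded eq] that lam[OF i]
      by (auto simp: zero_le_mult_iff split: if_splits)
    show "p * v i + q * (1 / mu i) + r \<le> 0" if "x i > 0"
      using first[of "\<lambda>j. if j = i then - 1 else 0", unfolded eq] that lam[OF i]
      by (auto simp: mult_le_0_iff split: if_splits)
  qed
  show ?thesis
  proof (cases "p \<noteq> 0 \<or> q \<noteq> 0 \<or> r \<noteq> 0")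
    case True
    show ?thesis
    proof (rule config_assignment_sign[OF n inj x(2) _ _ True])
      fix i assume i: "i \<in> {1..n}"
      show "x i = 0" if "p * v i + q * (1 / mu i) + r > 0"
        using kkt(2)[OF i] x(2)[OF i] that by force
      show "x i = 1" if "p * v i + q * (1 / mu i) + r < 0"
        using kkt(1)[OF i] x(2)[OF i] that by force
    qed
  next
    case False
    \<comment> \<open>\<open>p = r = 0\<close> says that both queues share the ratios
      \<open>C / D\<close> and \<open>A / D\<close>.\<close>
    define k where "k = C / D"
    define m where "m = A / D"
    have "k = C' / D'" "m = A' / D'" using False by (simp_all add: k_def m_def p_def r_def)
    then have "C' = k * D'" "A' = m * D'" using D by simp_all
    moreover have "C = k * D" "A = m * D" using D by (simp_all add: k_def m_def)
    ultimately have CA: "C = k * D" "C' = k * D'" "A = m * D" "A' = m * D'" by blast+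
    have km: "k > 0" "m > 0"
      using AC D unfolding CA distrib_right[symmetric] distrib_left[symmetric]
      by (simp_all add: zero_less_mult_iff)
    \<comment> \<open>Both quotients in \<open>q\<close> equal \<open>m * k\<close>, so
      \<open>q = 0\<close> forces equal capacities.\<close>
    have "\<alpha> * (m * k) = (1 - \<alpha>) * (m * k)"
      using False D by (simp add: q_def CA power2_eq_square)
    then have half: "\<alpha> = 1 / 2" using km by simp
    \<comment> \<open>With \<alpha> = 1/2 both denominators shift by the same \<open>t * d\<close>,
      in opposite directions. The exact change of the objective is then \<open>t\<^sup>2\<close>
      times this product times a positive factor.\<close>
    have second: "(sv h + m * (sm h / 2)) * (s1 h + k * (sm h / 2)) \<ge> 0"
      if h: "\<forall>i\<in>{1..n}. (h i > 0 \<longrightarrow> x i < 1) \<and> (h i < 0 \<longrightarrow> x i > 0)" for h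
    proof -
      define d where "d = sm h / 2"
      have lim: "((\<lambda>t. D - t * d) \<longlongrightarrow> D - 0 * d) (at_right 0)"
        "((\<lambda>t. D' + t * d) \<longlongrightarrow> D' + 0 * d) (at_right 0)" by (intro tendsto_intros)+
      have "\<forall>\<^sub>F t in at_right 0. D - t * d > 0" "\<forall>\<^sub>F t in at_right 0. D' + t * d > 0"
        using order_tendstoD(1)[OF lim(1), of 0] order_tendstoD(1)[OF lim(2), of 0] D
        by simp_all
      moreover have "\<forall>\<^sub>F t :: real in at_right 0. t > 0" by (rule eventually_at_right_less)
      ultimately have "\<forall>\<^sub>F t :: real in at_right 0. (sv h + m * d) * (s1 h + k * d) \<ge> 0"
        using minimal[OF h]
      proof eventually_elim
        case (elim t)
        have "0 \<le> t\<^sup>2 * ((sv h + m * d) * (s1 h + k * d)) * (1 / (D - t * d) + 1 / (D' + t * d))"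
          using elim(4) ratio_sum_critical[of D D' t d m "sv h" k "s1 h"] elim(1,2) D
          by (simp add: CA half d_def)
        moreover have "1 / (D - t * d) + 1 / (D' + t * d) > 0"
          using elim(1,2) by (simp add: add_pos_pos)
        ultimately show ?case using elim(3) by (simp add: zero_le_mult_iff)
      qed
      then show ?thesis unfolding d_def by simp
    qed
    \<comment> \<open>The two linear forms in \<open>second\<close> are the sums of
      \<open>lam i * h i * P i\<close> and of \<open>lam i * h i * Q i\<close>.\<close>
    define P where "P i = v i + m * (1 / mu i) / 2" for i
    define Q where "Q i = 1 + k * (1 / mu i) / 2" for i
    have PQ: "P i > 0" "Q i > 0" if "i \<in> {1..n}" for i
      using km v[OF that] mu[OF that] by (auto simp: P_def Q_def intro!: add_pos_pos)
    have exchange: "P i / Q i = P j / Q j"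
      if i: "i \<in> {1..n}" "x i > 0" and j: "j \<in> {1..n}" "x j < 1" for i j
    proof (cases "i = j")
      case ne: False
      \<comment> \<open>\<open>z / y\<close> is the mean of \<open>P i / P j\<close> and \<open>Q i / Q j\<close>, so the two linear forms below have
        opposite signs unless these ratios agree.\<close>
      define y z where "y = 2 * P j * Q j" and "z = P i * Q j + P j * Q i"
      have yz: "y > 0" "z > 0"
        unfolding y_def z_def using PQ[OF i(1)] PQ[OF j(1)] by (auto intro: add_pos_pos)
      \<comment> \<open>Type \<open>i\<close> leaves the first queue and type \<open>j\<close>
        enters it; dividing by \<open>lam\<close> cancels the arrival rates in all three
        sums.\<close>
      define h where
        "h = (\<lambda>l. (if l = i then - y / lam i else 0) + (if l = j then z / lam j else 0))"
      have add: "sv (\<lambda>l. f l + g l) = sv f + sv g" "sm (\<lambda>l. f l + g l) = sm f + sm g"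
        "s1 (\<lambda>l. f l + g l) = s1 f + s1 g" for f g
        unfolding sv_def sm_def s1_def distrib_left distrib_right add_divide_distrib sum.distrib
        by simp_all
      have lij: "lam i > 0" "lam j > 0" using lam i j by auto
      have sums: "sv h = z * v j - y * v i" "sm h = z / mu j - y / mu i" "s1 h = z - y"
        unfolding h_def add single[OF i(1)] single[OF j(1)] using lij by simp_all
      have "(sv h + m * (sm h / 2)) * (s1 h + k * (sm h / 2)) \<ge> 0"
      proof (rule second, intro ballI conjI impI)
        fix l
        have sgn_h: "h i < 0" "h j > 0" "l \<noteq> i \<Longrightarrow> l \<noteq> j \<Longrightarrow> h l = 0"
          using ne yz lij by (simp_all add: h_def)
        show "x l < 1" if "h l > 0"
          using that sgn_h j(2) by (cases "l = i"; cases "l = j") simp_all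
        show "x l > 0" if "h l < 0"
          using that sgn_h i(2) by (cases "l = i"; cases "l = j") simp_all
      qed
      moreover have "sv h + m * (sm h / 2) = z * P j - y * P i"
        "s1 h + k * (sm h / 2) = z * Q j - y * Q i"
        unfolding sums P_def Q_def by (simp_all add: algebra_simps diff_divide_distrib)
      moreover have "z * P j - y * P i = P j * (P j * Q i - P i * Q j)"
        "z * Q j - y * Q i = - (Q j * (P j * Q i - P i * Q j))"
        by (simp_all add: y_def z_def algebra_simps)
      ultimately have "P j * Q j * (P j * Q i - P i * Q j)\<^sup>2 \<le> 0"
        by (simp add: power2_eq_square mult_ac)
      then have "P j * Q i - P i * Q j = 0"
        using PQ[OF j(1)] by (simp add: mult_le_0_iff)
      then show ?thesis using PQ[OF i(1)] PQ[OF j(1)] by (simp add: frac_eq_eq)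
    qed simp
    consider "\<forall>i\<in>{1..n}. x i = 0" | "\<forall>i\<in>{1..n}. x i = 1"
      | i j where "i \<in> {1..n}" "x i > 0" "j \<in> {1..n}" "x j < 1"
    proof (cases "(\<exists>i\<in>{1..n}. x i > 0) \<and> (\<exists>j\<in>{1..n}. x j < 1)")
      case False
      then have "(\<forall>i\<in>{1..n}. x i = 0) \<or> (\<forall>i\<in>{1..n}. x i = 1)"
        using x(2) by (auto simp: not_less intro: antisym)
      then show ?thesis using that by blast
    qed (use that in blast)
    then show ?thesis
    proof cases
      case 1
      then show ?thesis by (intro config_assignment_all_0 n inj) blast
    next
      case 2
      then show ?thesis by (intro config_assignment_all_1 n inj) blast
    next
      case 3
      \<comment> \<open>A type with \<open>x l > 0\<close> is compared with \<open>j\<close>, any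
        other type with \<open>i\<close>; either way its ratio is \<open>c\<close>.\<close>
      define c where "c = P j / Q j"
      have "P l / Q l = c" if l: "l \<in> {1..n}" for l
      proof (cases "x l > 0")
        case True
        then show ?thesis using exchange[OF l _ 3(3,4)] unfolding c_def by blast
      next
        case False
        then have "P i / Q i = P l / Q l" by (intro exchange 3 l) simp
        then show ?thesis using exchange[OF 3] unfolding c_def by simp
      qed
      then have "P l = c * Q l" if "l \<in> {1..n}" for l
        using that PQ(2)[OF that] by (simp add: divide_eq_eq)
      then have "v l + m * (1 / mu l) / 2 = c * (1 + k * (1 / mu l) / 2)" if "l \<in> {1..n}" for l
        using that unfolding P_def Q_def .
      \<comment> \<open>Solving \<open>P l = c * Q l\<close> for \<open>v l\<close> gives a line
        through all points, so neither strict side imposes a condition.\<close>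
      then have "v l = (c * k - m) / 2 * (1 / mu l) + c" if "l \<in> {1..n}" for l
        using that by (simp add: algebra_simps diff_divide_distrib)
      then show ?thesis
        by (intro config_assignment_line[OF n inj x(2), where a = "(c * k - m) / 2" and b = c]) auto
    qed
  qed
qed

section \<open>Positive second moments and the boundary cases\<close>

lemma (in prob_space) second_moment_pos:
  fixes X :: "'a \<Rightarrow> real"
  assumes "integrable M (\<lambda>\<omega>. (X \<omega>)\<^sup>2)" "expectation X \<noteq> 0"
  shows "expectation (\<lambda>\<omega>. (X \<omega>)\<^sup>2) > 0"
proof -
  \<comment> \<open>The integral of a nonintegrable function is 0 by default, so a nonzero mean
    forces integrability.\<close>
  have "integrable M X" using assms(2) not_integrable_integral_eq by blast
  then have "variance X = expectation (\<lambda>\<omega>. (X \<omega>)\<^sup>2) - (expectation X)\<^sup>2"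
    using assms(1) by (rule variance_eq)
  then have "(expectation X)\<^sup>2 \<le> expectation (\<lambda>\<omega>. (X \<omega>)\<^sup>2)"
    using variance_positive[of X] by linarith
  moreover have "(expectation X)\<^sup>2 > 0" using assms(2) by simp
  ultimately show ?thesis by linarith
qed

theorem theorem1:
  fixes n :: nat and lam mu v x :: "nat \<Rightarrow> real" and \<alpha> :: real
    and M :: "'a measure" and S :: "nat \<Rightarrow> 'a \<Rightarrow> real"
  assumes "n \<ge> 2"
    and "\<And>i. i \<in> {1..n} \<Longrightarrow> lam i > 0"
    and "\<And>i. i \<in> {1..n} \<Longrightarrow> mu i > 0"
    and "\<And>i j. i \<in> {1..n} \<Longrightarrow> j \<in> {1..n} \<Longrightarrow> i < j \<Longrightarrow> mu i > mu j"
    and "prob_space M"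
    and "\<And>i. i \<in> {1..n} \<Longrightarrow> S i \<in> borel_measurable M"
    and "\<And>i. i \<in> {1..n} \<Longrightarrow> AE \<omega> in M. S i \<omega> \<ge> 0"
    and "\<And>i. i \<in> {1..n} \<Longrightarrow> integrable M (\<lambda>\<omega>. (S i \<omega>)\<^sup>2)"
    and "\<And>i. i \<in> {1..n} \<Longrightarrow> integral\<^sup>L M (S i) = 1 / mu i"
    and "\<And>i. i \<in> {1..n} \<Longrightarrow> integral\<^sup>L M (\<lambda>\<omega>. (S i \<omega>)\<^sup>2) = v i"
    and "\<alpha> \<in> {0..1}"
    and "QAP_optimal n lam mu v \<alpha> x"
  shows "\<exists>(U, E, L) \<in> configuration_set n mu v.
      ((\<forall>i\<in>U. x i = 1) \<and> (\<forall>i\<in>L. x i = 0) \<and> (\<forall>i\<in>E. x i \<in> {0..1})) \<or>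
      ((\<forall>i\<in>U. x i = 0) \<and> (\<forall>i\<in>L. x i = 1) \<and> (\<forall>i\<in>E. x i \<in> {0..1}))"
proof -
  have inj: "inj_on (\<lambda>i. 1 / mu i) {1..n}"
    using assms(4) by (intro linorder_inj_onI) fastforce+
  have v: "v i > 0" if i: "i \<in> {1..n}" for i
    using prob_space.second_moment_pos[OF assms(5) assms(8)[OF i]] assms(3,9,10)[OF i] by simp
  have "config_assignment n mu v x"
  proof (cases "0 < \<alpha> \<and> \<alpha> < 1")
    case True
    then show ?thesis
      using QAP_optimal_config_assignment[OF assms(1-3) inj v _ _ assms(12)] by blast
  next
    case False
    \<comment> \<open>With all capacity in one queue the only feasible assignment is
      constant.\<close>
    then have "\<alpha> = 0 \<or> \<alpha> = 1" using assms(11) by auto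
    moreover have "x \<in> stable_set n lam mu \<alpha>"
      using assms(12) unfolding QAP_optimal_def is_arg_min_linorder by blast
    ultimately have "(\<forall>i\<in>{1..n}. x i = 0) \<or> (\<forall>i\<in>{1..n}. x i = 1)"
      by (auto simp: stable_set_def)
    then show ?thesis
      using config_assignment_all_0[OF assms(1) inj] config_assignment_all_1[OF assms(1) inj]
      by blast
  qed
  then show ?thesis unfolding config_assignment_def .
qed

end
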